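(* Let $n$ be a positive integer and let $F = F(-n,b;\,c;\,z)$ where $b,c\in\mathbb{R}$ and $c>0$. (i) For $b>c+n$, all zeros of $F$ are real and lie in the interval $(0,1)$. (ii) For $c<b<c+n$: if $c+j-1<b<c+j$ with $j\in\{1,2,\dots,n\}$, then $F$ has $j$ real zeros in $(0,1)$. The remaining $(n-j)$ zeros of $F$ are all non-real if $(n-j)$ is even, while if $(n-j)$ is odd, $F$ has $(n-j-1)$ non-real zeros and one additional real zero in $(1,\infty)$. (iii) For $0<b<c$, all the zeros of $F$ are non-real if $n$ is even, while if $n$ is odd, $F$ has one real zero in $(1,\infty)$ and the other $(n-1)$ zeros are non-real. (iv) For $-n<b<0$: if $-j<b<-j+1$ with $j\in\{1,2,\dots,n\}$, then $F$ has $j$ real negative zeros. The remaining $(n-j)$ zeros of $F$ are all non-real if $(n-j)$ is even, while if $(n-j)$ is odd, $F$ has $(n-j-1)$ non-real zeros and one additional real zero in $(1,\infty)$. (v) For $b<-n$, all zeros of $F$ are real and negative.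
   Context: For a positive integer $n$ and real $b,c$ with $c\notin\{0,-1,\dots,-n+1\}$, $F(-n,b;\,c;\,z)$ denotes the hypergeometric polynomial in the complex variable $z$ $$F(-n,b;\,c;\,z) = 1+\sum_{k=1}^{n} \frac{(-n)_k (b)_k}{(c)_k}\frac{z^k}{k!},\qquad (\alpha)_k = \alpha(\alpha+1)\cdots(\alpha+k-1).$$ *)

theory Defs
  imports "HOL-Analysis.Analysis" "HOL-Computational_Algebra.Computational_Algebra"
begin

text \<open>
  The hypergeometric polynomial \<open>F(-n, b; c; z)\<close>. The parameter \<open>c\<close> is meant to avoid
  \<open>0, -1, ..., -n + 1\<close>; otherwise a coefficient contains a division by zero.
\<close>

definition hypergeom_poly :: "nat \<Rightarrow> real \<Rightarrow> real \<Rightarrow> complex poly" where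
  "hypergeom_poly n b c =
     1 + (\<Sum>k=1..n. monom (complex_of_real
           (pochhammer (- real n) k * pochhammer b k / (pochhammer c k * fact k))) k)"

text \<open>Zeros are counted with multiplicity.\<close>

definition num_zeros_in :: "complex poly \<Rightarrow> complex set \<Rightarrow> nat" where
  "num_zeros_in p S = size {#z \<in># proots p. z \<in> S#}"

end

theory Submission
  imports Defs
begin

text \<open>
  Three mechanisms locate the zeros of \<open>F(-n, b; c; z)\<close> for \<open>c > 0\<close>.

  The hypergeometric equation makes every real zero other than \<open>0\<close> and \<open>1\<close> simple
  (\<open>simple_zero_hyp\<close>), and it allows at most one zero in \<open>(1, \<infinity>)\<close>: after division by \<open>z\<^sup>n\<close> the
  equation reads \<open>(p G')' = q G\<close> with \<open>p, q > 0\<close>, and solutions of such an equation do not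
  oscillate (\<open>at_most_one_zero_beyond_1\<close>).

  Pfaff's transformation \<open>F(-n, b; c; z) = (1 - z)\<^sup>n F(-n, c - b; c; z / (z - 1))\<close> (\<open>pfaff\<close>)
  exchanges the interval \<open>(0, 1)\<close> with the negative axis and \<open>b\<close> with \<open>c - b\<close>. So it remains to
  find the number \<open>N(b)\<close> of negative zeros for every \<open>b\<close>: the total number of zeros is \<open>n\<close>, the
  number of nonreal zeros is even, and with at most one zero in \<open>(1, \<infinity>)\<close> the parity of
  \<open>n - N(b) - N(c - b)\<close> decides whether that zero exists (\<open>zero_counts\<close>).

  The numbers \<open>N(b)\<close> follow from Rolle's theorem. If \<open>b > 0\<close>, the polynomial is positive on
  the negative axis and \<open>N(b) = 0\<close>. If \<open>b < 1 - n\<close>, a Rodrigues type recursion in \<open>n\<close> yields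
  \<open>N(b) = n\<close> (\<open>card_neg_zeros_all\<close>). For \<open>b \<noteq> 0\<close>, the derivative of
  \<open>\<bar>z\<bar>\<^sup>b F(-n, b; c; z)\<close> on the negative axis is \<open>F(-n, b + 1; c; z)\<close> times a factor without
  zeros, whence \<open>N(b) \<le> N(b + 1) + 1\<close> (\<open>card_neg_zeros_step\<close>). Climbing from
  \<open>-j < b < -j + 1\<close> to positive parameters in \<open>j\<close> steps gives \<open>N(b) \<le> j\<close>, and descending to
  parameters below \<open>1 - n\<close> in \<open>n - j\<close> steps gives \<open>N(b) \<ge> j\<close> (\<open>card_neg_zeros_eq\<close>).
\<close>

section \<open>The real hypergeometric polynomial\<close>

text \<open>
  The polynomial has real coefficients, so the analysis takes place over the reals. Writing
  \<open>(-1)\<^sup>k (n choose k)\<close> for \<open>(-n)\<^sub>k / k!\<close> displays the signs: at a negative argument, and for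
  \<open>c > 0\<close>, the \<open>k\<close>-th term has the sign of \<open>(b)\<^sub>k\<close>.
\<close>
definition hyp :: "nat \<Rightarrow> real \<Rightarrow> real \<Rightarrow> real poly" where
  "hyp n b c = (\<Sum>k\<le>n. monom ((- 1) ^ k * real (n choose k) * pochhammer b k / pochhammer c k) k)"

lemma coeff_hyp:
  "coeff (hyp n b c) k = (- 1) ^ k * real (n choose k) * pochhammer b k / pochhammer c k"
proof (cases "k \<le> n")
  case True
  then show ?thesis
    by (simp add: hyp_def coeff_sum)
next
  case False
  then show ?thesis
    by (simp add: hyp_def coeff_sum binomial_eq_0)
qed

lemma poly_hyp:
  "poly (hyp n b c) x =
     (\<Sum>k\<le>n. real (n choose k) * pochhammer b k / pochhammer c k * (- x) ^ k)"
  unfolding hyp_def poly_sum poly_monom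
  by (intro sum.cong refl) (simp add: power_minus[of x] mult_ac)

lemma hypergeom_poly_eq_hyp: "hypergeom_poly n b c = map_poly complex_of_real (hyp n b c)"
proof (intro poly_eqI)
  fix k
  have eq: "pochhammer (- real n) k / fact k = (- 1) ^ k * real (n choose k)"
    by (simp add: binomial_gbinomial gbinomial_pochhammer flip: mult.assoc power_mult_distrib)
  have "coeff (hypergeom_poly n b c) k = (if k \<le> n then complex_of_real
      (pochhammer (- real n) k / fact k * pochhammer b k / pochhammer c k) else 0)"
    by (cases k) (auto simp: hypergeom_poly_def coeff_sum mult_ac)
  also have "\<dots> = complex_of_real (coeff (hyp n b c) k)"
    unfolding eq coeff_hyp by (auto simp: binomial_eq_0)
  finally show "coeff (hypergeom_poly n b c) k = coeff (map_poly complex_of_real (hyp n b c)) k"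
    by (simp add: coeff_map_poly)
qed

lemma poly_hyp_0 [simp]: "poly (hyp n b c) 0 = 1"
  by (simp add: poly_0_coeff_0 coeff_hyp)

lemma hyp_nonzero [simp]: "hyp n b c \<noteq> 0"
  by (metis poly_0 poly_hyp_0 zero_neq_one)

lemma finite_zeros: "finite {x \<in> S. poly (hyp n b c) x = 0}"
  by (rule finite_subset[OF _ poly_roots_finite[OF hyp_nonzero]]) auto

lemma degree_hyp:
  assumes "c > 0" "pochhammer b n \<noteq> 0"
  shows "degree (hyp n b c) = n"
proof (rule antisym)
  show "degree (hyp n b c) \<le> n"
    by (rule degree_le) (auto simp: coeff_hyp binomial_eq_0)
  have "pochhammer c n > 0"
    using assms by (intro pochhammer_pos)
  then show "n \<le> degree (hyp n b c)"
    using assms by (intro le_degree) (auto simp: coeff_hyp)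
qed

lemma sum_pos_first:
  fixes f :: "nat \<Rightarrow> real"
  assumes "f 0 = 1" "\<And>k. k \<le> n \<Longrightarrow> f k \<ge> 0"
  shows "(\<Sum>k\<le>n. f k) > 0"
  by (rule sum_pos2[of _ 0]) (use assms in auto)

lemma hyp_pos_negative_axis:
  assumes "c > 0" "b > 0" "x < 0"
  shows "poly (hyp n b c) x > 0"
  unfolding poly_hyp
proof (rule sum_pos_first)
  fix k
  have "pochhammer c k > 0" "pochhammer b k > 0"
    using assms by (auto intro: pochhammer_pos)
  then show "real (n choose k) * pochhammer b k / pochhammer c k * (- x) ^ k \<ge> 0"
    using assms by simp
qed simp

text \<open>
  For \<open>b < 1 - n\<close> every factor of \<open>(b)\<^sub>k\<close> with \<open>k \<le> n\<close> is negative, so \<open>(b)\<^sub>k\<close> absorbs the sign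
  \<open>(-1)\<^sup>k\<close> and all coefficients are positive.
\<close>
lemma hyp_pos_positive_axis:
  assumes "c > 0" "b < 1 - real n" "x \<ge> 0"
  shows "poly (hyp n b c) x > 0"
  unfolding poly_hyp
proof (rule sum_pos_first)
  fix k assume k: "k \<le> n"
  have "pochhammer c k > 0"
    using assms by (auto intro: pochhammer_pos)
  moreover have "pochhammer b k * (- 1) ^ k = (\<Prod>i<k. (- b - real i))"
    by (induction k) (auto simp: pochhammer_Suc algebra_simps)
  moreover have "(\<Prod>i<k. (- b - real i)) \<ge> 0"
    using assms k by (intro prod_nonneg) auto
  ultimately have "0 \<le> real (n choose k) * (pochhammer b k * (- 1) ^ k) / pochhammer c k * x ^ k"
    using assms by simp
  also have "\<dots> = real (n choose k) * pochhammer b k / pochhammer c k * (- x) ^ k"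
    by (simp add: power_minus[of x])
  finally show "real (n choose k) * pochhammer b k / pochhammer c k * (- x) ^ k \<ge> 0" .
qed simp

section \<open>Contiguous relations and the differential equation\<close>

lemma binomial_step: "(real k + 1) * real (n choose Suc k) = (real n - real k) * real (n choose k)"
proof (cases "k \<le> n")
  case True
  have "Suc k * (n choose Suc k) = (n - k) * (n choose k)"
    by (simp only: binomial_absorption binomial_absorb_comp)
  then have "real (Suc k * (n choose Suc k)) = real ((n - k) * (n choose k))" by simp
  then show ?thesis using True by (simp add: of_nat_diff algebra_simps)
qed (simp add: binomial_eq_0)

text \<open>
  The two-term recurrence of the coefficients; the hypergeometric equation is its translation to
  polynomials.
\<close>
lemma coeff_hyp_Suc:
  assumes "c > 0"
  shows "(real k + 1) * (real k + c) * coeff (hyp n b c) (Suc k) =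
         (real k - real n) * (real k + b) * coeff (hyp n b c) k"
proof -
  have "pochhammer c k > 0" using assms by (rule pochhammer_pos)
  then have "(real k + 1) * (real k + c) * coeff (hyp n b c) (Suc k) =
     - ((- 1) ^ k * ((real k + 1) * real (n choose Suc k)) * (real k + b) * pochhammer b k / pochhammer c k)"
    using assms by (simp add: coeff_hyp pochhammer_rec' divide_simps) (simp add: algebra_simps)
  also have "\<dots> = (real k - real n) * (real k + b) * coeff (hyp n b c) k"
    unfolding binomial_step coeff_hyp by (simp add: divide_inverse algebra_simps)
  finally show ?thesis .
qed

lemma hyp_ode_poly:
  assumes "c > 0"
  shows "[:0, 1, -1:] * pderiv (pderiv (hyp n b c)) + [:c, real n - 1 - b:] * pderiv (hyp n b c)
         + smult (real n * b) (hyp n b c) = 0" (is "?lhs = 0")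
proof (intro poly_eqI)
  fix k
  let ?r = "coeff (hyp n b c)"
  have "coeff ?lhs k = (real k + 1) * (real k + c) * ?r (Suc k) - (real k - real n) * (real k + b) * ?r k"
    by (auto simp: coeff_pCons coeff_pderiv split: nat.splits) (auto simp: algebra_simps)
  then show "coeff ?lhs k = coeff 0 k"
    using coeff_hyp_Suc[OF assms, of k n b] by simp
qed

lemma hyp_ode:
  assumes "c > 0"
  shows "x * (1 - x) * poly (pderiv (pderiv (hyp n b c))) x
         + (c - (b - real n + 1) * x) * poly (pderiv (hyp n b c)) x
         + real n * b * poly (hyp n b c) x = 0"
  using arg_cong[OF hyp_ode_poly[OF assms, of n b], of "\<lambda>p. poly p x"] by (simp add: algebra_simps)

text \<open>
  The operator \<open>x d/dx + b\<close> multiplies the \<open>k\<close>-th coefficient by \<open>k + b\<close> and so shifts \<open>b\<close>. Up to a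
  weight it is the derivative of \<open>\<bar>x\<bar>\<^sup>b F\<close>, which makes Rolle's theorem applicable.
\<close>
lemma hyp_raise_b:
  "b * poly (hyp n b c) x + x * poly (pderiv (hyp n b c)) x = b * poly (hyp n (b + 1) c) x"
proof -
  have "smult b (hyp n b c) + pCons 0 (pderiv (hyp n b c)) = smult b (hyp n (b + 1) c)"
  proof (intro poly_eqI)
    fix k
    have "(b + real k) * pochhammer b k = b * pochhammer (b + 1) k"
      by (metis pochhammer_rec pochhammer_rec')
    then have eq: "b * pochhammer b k + real k * pochhammer b k = b * pochhammer (b + 1) k"
      by (simp add: algebra_simps)
    have "coeff (smult b (hyp n b c) + pCons 0 (pderiv (hyp n b c))) k =
       (b + real k) * coeff (hyp n b c) k"
      by (cases k) (auto simp: coeff_pderiv algebra_simps)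
    also have "\<dots> = (- 1) ^ k * real (n choose k) * (b * pochhammer b k + real k * pochhammer b k) / pochhammer c k"
      by (simp add: coeff_hyp field_simps)
    also have "\<dots> = coeff (smult b (hyp n (b + 1) c)) k"
      unfolding eq by (simp add: coeff_hyp)
    finally show "coeff (smult b (hyp n b c) + pCons 0 (pderiv (hyp n b c))) k =
        coeff (smult b (hyp n (b + 1) c)) k" .
  qed
  then have "poly (smult b (hyp n b c) + pCons 0 (pderiv (hyp n b c))) x = poly (smult b (hyp n (b + 1) c)) x"
    by (rule arg_cong)
  then show ?thesis by simp
qed

text \<open>
  One step of a Rodrigues formula: the left-hand side is, up to a weight, the derivative of
  \<open>\<bar>x\<bar>\<^sup>c (1 - x)\<^bsup>b - c\<^esup> F(-n, b; c + 1; x)\<close>. The degree goes up by one, and because \<open>c > 0\<close> the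
  weighted function has the additional zero \<open>0\<close>.
\<close>
lemma hyp_raise_n:
  assumes "c > 0"
  shows "(c - b * x) * poly (hyp n b (c + 1)) x + x * (1 - x) * poly (pderiv (hyp n b (c + 1))) x
         = c * poly (hyp (Suc n) b c) x"
proof -
  let ?q = "hyp n b (c + 1)"
  have "[:c, - b:] * ?q + [:0, 1, -1:] * pderiv ?q = smult c (hyp (Suc n) b c)" (is "?l = _")
  proof (intro poly_eqI)
    fix k
    have shift: "(c + real k) * coeff (hyp m b (c + 1)) k = c * coeff (hyp m b c) k" for m k
    proof -
      have "pochhammer c k > 0"
        using assms by (rule pochhammer_pos)
      moreover have "c * pochhammer (c + 1) k = (c + real k) * pochhammer c k"
        by (metis pochhammer_rec pochhammer_rec')
      then have "pochhammer (c + 1) k = (c + real k) * pochhammer c k / c"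
        using assms by (simp add: field_simps)
      ultimately show ?thesis
        using assms by (simp add: coeff_hyp)
    qed
    show "coeff ?l k = coeff (smult c (hyp (Suc n) b c)) k"
    proof (cases k)
      case 0
      then show ?thesis by (simp add: coeff_hyp)
    next
      case (Suc j)
      have "coeff ?l k = (c + real k) * coeff ?q k - (b + real j) * coeff ?q j"
        unfolding Suc by (auto simp: coeff_pCons coeff_pderiv algebra_simps split: nat.splits)
      also have "\<dots> = c * coeff (hyp n b c) (Suc j) - (b + real j) * (c * coeff (hyp n b c) j / (c + real j))"
        unfolding shift Suc using shift[of j n] assms
        by (simp add: eq_divide_eq mult.commute)
      also have "\<dots> = c * coeff (hyp (Suc n) b c) (Suc j)"
      proof -
        have "pochhammer c j > 0" using assms by (rule pochhammer_pos)
        then show ?thesis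
          using assms by (simp add: coeff_hyp pochhammer_rec' divide_simps) (simp add: algebra_simps)
      qed
      finally show ?thesis by (simp add: Suc)
    qed
  qed
  from arg_cong[OF this, of "\<lambda>p. poly p x"] show ?thesis by (simp add: algebra_simps)
qed

section \<open>The Pfaff transformation\<close>

text \<open>
  The Euler transform of a finite sequence. After interchanging the sums,
  \<open>(n choose m) (m choose k) = (n choose k) (n - k choose m - k)\<close> turns the inner sum into the
  binomial expansion of \<open>(1 - x)\<^bsup>n - k\<^esup>\<close>.
\<close>
lemma alternating_binomial_transform:
  fixes a :: "nat \<Rightarrow> real"
  shows "(\<Sum>m\<le>n. real (n choose m) * (\<Sum>k\<le>m. (- 1) ^ k * real (m choose k) * a k) * (- x) ^ m) =
         (\<Sum>k\<le>n. real (n choose k) * a k * x ^ k * (1 - x) ^ (n - k))"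
proof -
  have "(\<Sum>m\<le>n. real (n choose m) * (\<Sum>k\<le>m. (- 1) ^ k * real (m choose k) * a k) * (- x) ^ m) =
        (\<Sum>m\<le>n. \<Sum>k\<le>n. real (n choose m) * ((- 1) ^ k * real (m choose k) * a k) * (- x) ^ m)"
  proof (intro sum.cong refl)
    fix m assume "m \<in> {..n}"
    then have "(\<Sum>k\<le>m. (- 1) ^ k * real (m choose k) * a k) = (\<Sum>k\<le>n. (- 1) ^ k * real (m choose k) * a k)"
      by (intro sum.mono_neutral_left) (auto simp: binomial_eq_0)
    then show "real (n choose m) * (\<Sum>k\<le>m. (- 1) ^ k * real (m choose k) * a k) * (- x) ^ m =
        (\<Sum>k\<le>n. real (n choose m) * ((- 1) ^ k * real (m choose k) * a k) * (- x) ^ m)"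
      by (simp add: sum_distrib_left sum_distrib_right)
  qed
  also have "\<dots> = (\<Sum>k\<le>n. \<Sum>m\<le>n. real (n choose m) * ((- 1) ^ k * real (m choose k) * a k) * (- x) ^ m)"
    by (rule sum.swap)
  also have "\<dots> = (\<Sum>k\<le>n. real (n choose k) * a k * x ^ k * (1 - x) ^ (n - k))"
  proof (intro sum.cong refl)
    fix k assume "k \<in> {..n}"
    then have k: "k \<le> n" by simp
    have "(\<Sum>m\<le>n. real (n choose m) * ((- 1) ^ k * real (m choose k) * a k) * (- x) ^ m) =
          (\<Sum>m=k..n. real (n choose m) * ((- 1) ^ k * real (m choose k) * a k) * (- x) ^ m)"
      by (intro sum.mono_neutral_right) (auto simp: binomial_eq_0)
    also have "\<dots> = (\<Sum>i\<le>n-k. real (n choose (i + k)) * ((- 1) ^ k * real ((i + k) choose k) * a k) * (- x) ^ (i + k))"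
      using k sum.shift_bounds_cl_nat_ivl[of "\<lambda>m. real (n choose m) * ((- 1) ^ k * real (m choose k) * a k) * (- x) ^ m" 0 k "n - k"]
      by (simp add: atMost_atLeast0)
    also have "\<dots> = (\<Sum>i\<le>n-k. real (n choose k) * a k * x ^ k * (real ((n - k) choose i) * (- x) ^ i * 1 ^ (n - k - i)))"
    proof (intro sum.cong refl)
      fix i assume "i \<in> {..n-k}"
      then have "(n choose (i + k)) * ((i + k) choose k) = (n choose k) * ((n - k) choose i)"
        using choose_mult[of k "i + k" n] k by simp
      then have *: "real (n choose (i + k)) * real ((i + k) choose k) = real (n choose k) * real ((n - k) choose i)"
        by (metis of_nat_mult)
      have "real (n choose (i + k)) * ((- 1) ^ k * real ((i + k) choose k) * a k) * (- x) ^ (i + k) =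
        (real (n choose (i + k)) * real ((i + k) choose k)) * a k * ((- 1) ^ k * (- x) ^ k) * (- x) ^ i"
        by (simp add: power_add mult_ac)
      also have "(- 1) ^ k * (- x) ^ k = x ^ k"
        by (simp flip: power_mult_distrib)
      finally show "real (n choose (i + k)) * ((- 1) ^ k * real ((i + k) choose k) * a k) * (- x) ^ (i + k) =
        real (n choose k) * a k * x ^ k * (real ((n - k) choose i) * (- x) ^ i * 1 ^ (n - k - i))"
        unfolding * by (simp add: mult_ac)
    qed
    also have "\<dots> = real (n choose k) * a k * x ^ k * (1 - x) ^ (n - k)"
      using binomial_ring[of "- x" 1 "n - k"] by (simp add: sum_distrib_left)
    finally show "(\<Sum>m\<le>n. real (n choose m) * ((- 1) ^ k * real (m choose k) * a k) * (- x) ^ m) =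
      real (n choose k) * a k * x ^ k * (1 - x) ^ (n - k)" .
  qed
  finally show ?thesis .
qed

lemma Chu_Vandermonde:
  fixes a c :: real
  assumes "c > 0"
  shows "(\<Sum>k\<le>m. (- 1) ^ k * real (m choose k) * (pochhammer a k / pochhammer c k)) =
         pochhammer (c - a) m / pochhammer c m"
proof -
  have "(\<Sum>k\<le>m. (- 1) ^ k * real (m choose k) * (pochhammer a k / pochhammer c k)) =
    (\<Sum>k=0..m. pochhammer a k * pochhammer (- real m) k / (of_nat (fact k) * pochhammer c k))"
    unfolding atMost_atLeast0
    by (intro sum.cong refl)
       (simp add: binomial_gbinomial gbinomial_pochhammer flip: mult.assoc power_mult_distrib)
  also have "\<dots> = pochhammer (c - a) m / pochhammer c m"
    by (rule Vandermonde_pochhammer) (use assms in auto)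
  finally show ?thesis .
qed

lemma poly_hyp_1:
  assumes "c > 0"
  shows "poly (hyp n b c) 1 = pochhammer (c - b) n / pochhammer c n"
  using Chu_Vandermonde[OF assms, of n b] by (simp add: poly_hyp mult_ac)

text \<open>
  By the Chu-Vandermonde identity, \<open>(b)\<^sub>m / (c)\<^sub>m\<close> is the alternating binomial transform of
  \<open>(c - b)\<^sub>k / (c)\<^sub>k\<close>, so the Euler transform applies. The involution \<open>x \<mapsto> x / (x - 1)\<close> exchanges
  \<open>(0, 1)\<close> with the negative axis, and so the parameter \<open>b\<close> with \<open>c - b\<close>.
\<close>
lemma pfaff:
  assumes "c > 0" "x \<noteq> 1"
  shows "poly (hyp n b c) x = (1 - x) ^ n * poly (hyp n (c - b) c) (x / (x - 1))"
proof -
  have "poly (hyp n b c) x = (\<Sum>m\<le>n. real (n choose m) *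
      (\<Sum>k\<le>m. (- 1) ^ k * real (m choose k) * (pochhammer (c - b) k / pochhammer c k)) * (- x) ^ m)"
    unfolding Chu_Vandermonde[OF assms(1)] by (simp add: poly_hyp)
  also have "\<dots> = (\<Sum>k\<le>n. real (n choose k) * (pochhammer (c - b) k / pochhammer c k) * x ^ k * (1 - x) ^ (n - k))"
    by (rule alternating_binomial_transform)
  also have "\<dots> = (1 - x) ^ n * poly (hyp n (c - b) c) (x / (x - 1))"
    unfolding poly_hyp sum_distrib_left
  proof (intro sum.cong refl)
    fix k assume "k \<in> {..n}"
    then have "(1 - x) ^ n = (1 - x) ^ (n - k) * (1 - x) ^ k"
      by (simp flip: power_add)
    moreover have "(1 - x) * (- (x / (x - 1))) = x"
      using assms by (simp add: field_simps)
    then have "(1 - x) ^ k * (- (x / (x - 1))) ^ k = x ^ k"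
      by (metis power_mult_distrib)
    ultimately show "real (n choose k) * (pochhammer (c - b) k / pochhammer c k) * x ^ k * (1 - x) ^ (n - k) =
      (1 - x) ^ n * (real (n choose k) * pochhammer (c - b) k / pochhammer c k * (- (x / (x - 1))) ^ k)"
      by (simp add: mult_ac)
  qed
  finally show ?thesis .
qed

section \<open>Counting zeros with multiplicity\<close>

lemma num_zeros_in_UNIV: "num_zeros_in p UNIV = degree p"
  by (simp add: num_zeros_in_def size_proots_complex)

lemma num_zeros_in_Un:
  assumes "A \<inter> B = {}"
  shows "num_zeros_in p (A \<union> B) = num_zeros_in p A + num_zeros_in p B"
proof -
  have "{#z \<in># proots p. z \<in> A \<union> B#} = {#z \<in># proots p. z \<in> A#} + {#z \<in># proots p. z \<in> B#}"
    using assms by (intro multiset_eqI) auto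
  then show ?thesis by (simp add: num_zeros_in_def)
qed

lemma num_zeros_in_eq_0_iff:
  assumes "p \<noteq> 0"
  shows "num_zeros_in p S = 0 \<longleftrightarrow> (\<forall>z\<in>S. poly p z \<noteq> 0)"
  using assms by (auto simp: num_zeros_in_def)

lemma num_zeros_in_simple:
  assumes "p \<noteq> 0" "\<And>z. z \<in> S \<Longrightarrow> poly p z = 0 \<Longrightarrow> poly (pderiv p) z \<noteq> 0"
  shows "num_zeros_in p S = card {z \<in> S. poly p z = 0}"
proof -
  have "finite {z \<in> S. poly p z = 0}"
    by (rule finite_subset[OF _ poly_roots_finite[OF assms(1)]]) auto
  moreover have "order z p = 1" if "z \<in> S" "poly p z = 0" for z
    using order_pderiv[OF assms(1) that(2)] assms(2)[OF that] by (simp add: order_0I)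
  then have "{#z \<in># proots p. z \<in> S#} = mset_set {z \<in> S. poly p z = 0}"
    using assms(1) calculation by (intro multiset_eqI) (auto simp: count_mset_set' order_0I)
  ultimately show ?thesis by (simp add: num_zeros_in_def)
qed

abbreviation cpoly :: "real poly \<Rightarrow> complex poly" where
  "cpoly \<equiv> map_poly complex_of_real"

lemma poly_cpoly: "poly (cpoly r) (complex_of_real x) = complex_of_real (poly r x)"
  by (induction r) (auto simp: map_poly_pCons)

lemma pderiv_cpoly: "pderiv (cpoly r) = cpoly (pderiv r)"
  by (intro poly_eqI) (simp add: coeff_pderiv coeff_map_poly)

lemma num_zeros_in_real:
  assumes "r \<noteq> 0" "\<And>x. x \<in> T \<Longrightarrow> poly r x = 0 \<Longrightarrow> poly (pderiv r) x \<noteq> 0"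
  shows "num_zeros_in (cpoly r) (complex_of_real ` T) = card {x \<in> T. poly r x = 0}"
proof -
  have "num_zeros_in (cpoly r) (complex_of_real ` T) = card {z \<in> complex_of_real ` T. poly (cpoly r) z = 0}"
    using assms by (intro num_zeros_in_simple) (auto simp: map_poly_eq_0_iff pderiv_cpoly poly_cpoly)
  also have "{z \<in> complex_of_real ` T. poly (cpoly r) z = 0} = complex_of_real ` {x \<in> T. poly r x = 0}"
    by (auto simp: poly_cpoly)
  also have "card \<dots> = card {x \<in> T. poly r x = 0}"
    by (intro card_image inj_onI) auto
  finally show ?thesis .
qed

text \<open>
  Conjugating a factorization \<open>p = (x - z)\<^sup>m q\<close> of a polynomial with real coefficients exhibits
  \<open>cnj z\<close> as a zero of at least the same order.
\<close>
lemma order_cnj_le: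
  assumes "map_poly cnj p = p" "p \<noteq> 0"
  shows "order z p \<le> order (cnj z) p"
proof -
  obtain q where q: "p = [:- z, 1:] ^ order z p * q"
    using order_1[of z p] by (elim dvdE)
  have "poly p x = poly ([:- cnj z, 1:] ^ order z p * map_poly cnj q) x" for x
  proof -
    have "poly p x = cnj (poly p (cnj x))"
      by (subst (1) assms(1)[symmetric]) simp
    also have "\<dots> = cnj (poly ([:- z, 1:] ^ order z p * q) (cnj x))"
      using q by simp
    finally show ?thesis by (simp add: poly_power)
  qed
  then have "p = [:- cnj z, 1:] ^ order z p * map_poly cnj q"
    by (intro poly_ext)
  then have "[:- cnj z, 1:] ^ order z p dvd p" by (metis dvd_triv_left)
  then show ?thesis using order_divides assms(2) by blast
qed

text \<open>
  Conjugation maps the zeros in the upper half plane to those in the lower one and preserves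
  multiplicities.
\<close>
lemma even_nonreal_zeros: "even (num_zeros_in (cpoly r) (- \<real>))"
proof (cases "r = 0")
  case False
  let ?p = "cpoly r"
  have real: "map_poly cnj ?p = ?p"
    by (intro poly_eqI) (simp add: coeff_map_poly)
  have nz: "?p \<noteq> 0" using False by (simp add: map_poly_eq_0_iff)
  have order_cnj: "order (cnj z) ?p = order z ?p" for z
    using order_cnj_le[OF real nz, of z] order_cnj_le[OF real nz, of "cnj z"] by simp
  have "image_mset cnj {#z \<in># proots ?p. Im z > 0#} = {#z \<in># proots ?p. Im z < 0#}" (is "image_mset cnj ?U = ?L")
  proof (rule multiset_eqI)
    fix z
    have "count (image_mset cnj M) z = count M (cnj z)" for M
      by (induction M) auto
    then show "count (image_mset cnj ?U) z = count ?L z"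
      using nz by (simp add: order_cnj)
  qed
  then have "size ?L = size ?U" by (metis size_image_mset)
  moreover have nonreal: "- \<real> = {z. Im z > 0} \<union> {z. Im z < 0}"
    by (auto simp: complex_is_Real_iff)
  have "num_zeros_in ?p (- \<real>) = num_zeros_in ?p {z. Im z > 0} + num_zeros_in ?p {z. Im z < 0}"
    unfolding nonreal by (rule num_zeros_in_Un) auto
  ultimately show ?thesis by (simp add: num_zeros_in_def)
qed (simp add: num_zeros_in_def)

section \<open>Simplicity of the real zeros\<close>

text \<open>
  If \<open>x\<close> were a zero of order \<open>m \<ge> 2\<close>, then \<open>(X - x)\<^bsup>m - 1\<^esup>\<close> would divide \<open>p\<close> and \<open>p'\<close>, hence
  \<open>A p''\<close>; but \<open>A p''\<close> has order \<open>m - 2\<close> at the regular point \<open>x\<close>.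
\<close>
lemma simple_zero_of_ode:
  fixes p :: "real poly"
  assumes ode: "A * pderiv (pderiv p) + B * pderiv p + C * p = 0"
    and "p \<noteq> 0" "poly A x \<noteq> 0" "poly p x = 0"
  shows "poly (pderiv p) x \<noteq> 0"
proof
  assume d: "poly (pderiv p) x = 0"
  have d0: "pderiv p \<noteq> 0"
  proof
    assume "pderiv p = 0"
    then obtain h where "p = [:h:]" using pderiv_iszero by blast
    then show False using assms by auto
  qed
  have dd0: "pderiv (pderiv p) \<noteq> 0"
  proof
    assume "pderiv (pderiv p) = 0"
    then obtain h where "pderiv p = [:h:]" using pderiv_iszero by blast
    then show False using d d0 by auto
  qed
  let ?m = "order x (pderiv p)"
  have m: "?m = Suc (order x (pderiv (pderiv p)))" "order x p = Suc ?m"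
    using order_pderiv d d0 assms by blast+
  have "[:- x, 1:] ^ ?m dvd p"
    using m(2) by (intro power_le_dvd[OF order_1]) simp
  moreover have "[:- x, 1:] ^ ?m dvd pderiv p" by (rule order_1)
  ultimately have "[:- x, 1:] ^ ?m dvd - (B * pderiv p + C * p)"
    by simp
  also have "- (B * pderiv p + C * p) = A * pderiv (pderiv p)"
    using ode by (intro minus_unique) (simp add: add_ac)
  finally have dvd: "[:- x, 1:] ^ ?m dvd A * pderiv (pderiv p)" .
  have nz: "A * pderiv (pderiv p) \<noteq> 0"
    using dd0 assms(3) by auto
  have "?m \<le> order x (A * pderiv (pderiv p))"
    using dvd nz order_divides by blast
  also have "\<dots> = order x A + order x (pderiv (pderiv p))"
    using nz by (rule order_mult)
  also have "order x A = 0" using assms(3) by (rule order_0I)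
  finally show False using m(1) by simp
qed

lemma simple_zero_hyp:
  assumes "c > 0" "x \<noteq> 0" "x \<noteq> 1" "poly (hyp n b c) x = 0"
  shows "poly (pderiv (hyp n b c)) x \<noteq> 0"
proof (rule simple_zero_of_ode)
  show "[:0, 1, -1:] * pderiv (pderiv (hyp n b c)) + [:c, real n - 1 - b:] * pderiv (hyp n b c)
         + [:real n * b:] * hyp n b c = 0"
    using hyp_ode_poly[OF assms(1), of n b] by simp
qed (use assms in auto)

section \<open>Zeros between zeros\<close>

text \<open>
  Rolle's theorem in the form used throughout: the derivative of an auxiliary function \<open>f\<close> is a
  nonvanishing weight times the function \<open>h\<close> whose zeros are sought. No derivative is required at
  the end points, where the weight may be singular.
\<close>
lemma weighted_Rolle:
  fixes f h w :: "real \<Rightarrow> real"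
  assumes "x < y" "f x = 0" "f y = 0" "continuous_on {x..y} f"
    and der: "\<And>t. x < t \<Longrightarrow> t < y \<Longrightarrow> (f has_real_derivative w t * h t) (at t)"
    and nz: "\<And>t. x < t \<Longrightarrow> t < y \<Longrightarrow> w t \<noteq> 0"
  obtains z where "x < z" "z < y" "h z = 0"
proof -
  have "\<exists>z. x < z \<and> z < y \<and> (f has_real_derivative 0) (at z)"
  proof (rule Rolle)
    show "f differentiable at t" if "x < t" "t < y" for t
      using der[OF that] real_differentiable_def by blast
  qed (use assms in auto)
  then obtain z where z: "x < z" "z < y" "(f has_real_derivative 0) (at z)"
    by blast
  then have "w z * h z = 0"
    using DERIV_unique[OF der[of z]] by blast
  then show ?thesis using z nz that by auto
qed

text \<open>
  Counting form of interlacing. It gives upper bounds for \<open>card S\<close> and lower bounds for \<open>card T\<close>;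
  with \<open>T = {}\<close> it says that a set without two distinct elements has at most one.
\<close>
lemma card_le_interlacing:
  fixes S T :: "real set"
  assumes "finite S" "finite T"
    and "\<And>x y. x \<in> S \<Longrightarrow> y \<in> S \<Longrightarrow> x < y \<Longrightarrow> \<exists>z\<in>T. x < z \<and> z < y"
  shows "card S \<le> card T + 1"
  using assms
proof (induction S arbitrary: T rule: finite_linorder_max_induct)
  case empty
  then show ?case by simp
next
  case (insert b A)
  show ?case
  proof (cases "A = {}")
    case False
    define a where "a = Max A"
    have a: "a \<in> A" "\<And>x. x \<in> A \<Longrightarrow> x \<le> a"
      using insert.hyps False by (auto simp: a_def)
    then obtain z where z: "z \<in> T" "a < z" "z < b"
      using insert.prems(2)[of a b] insert.hyps by auto
    have "card A \<le> card {t \<in> T. t < a} + 1"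
    proof (rule insert.IH)
      fix x y assume "x \<in> A" "y \<in> A" "x < y"
      then obtain t where "t \<in> T" "x < t" "t < y" using insert.prems(2)[of x y] by auto
      then show "\<exists>z\<in>{t \<in> T. t < a}. x < z \<and> z < y" using a(2)[OF \<open>y \<in> A\<close>] by force
    qed (use insert.prems in auto)
    moreover have "card {t \<in> T. t < a} < card T"
    proof (rule psubset_card_mono)
      have "z \<notin> {t \<in> T. t < a}" using z by simp
      then show "{t \<in> T. t < a} \<subset> T" using z(1) by blast
    qed (use insert.prems in auto)
    moreover have "b \<notin> A" using insert.hyps by auto
    ultimately show ?thesis using insert.hyps by simp
  qed simp
qed

section \<open>Zeros beyond 1\<close>

text \<open>
  The function \<open>G = F / x\<^sup>n\<close> satisfies \<open>(p G')' = q G\<close> on \<open>(1, \<infinity>)\<close> with positive \<open>p\<close> and \<open>q\<close>, since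
  \<open>n (n + c - 1) > 0\<close>. Between two zeros of \<open>G\<close>, Rolle's theorem for \<open>p G G'\<close> gives a point where
  \<open>(p G G')' = p G'\<^sup>2 + q G\<^sup>2\<close> vanishes, that is, a double zero of \<open>F\<close>; but the zeros are simple.
  Below, \<open>S = x F' - n F = x\<^bsup>n + 1\<^esup> G'\<close>, and \<open>f\<close> is \<open>p G G'\<close> written without denominators.
\<close>
lemma at_most_one_zero_beyond_1:
  assumes "c > 0" "n \<ge> 1"
  shows "card {x. x > 1 \<and> poly (hyp n b c) x = 0} \<le> 1"
proof -
  let ?r = "poly (hyp n b c)" and ?r' = "poly (pderiv (hyp n b c))"
    and ?r'' = "poly (pderiv (pderiv (hyp n b c)))"
  have no_two: False if xy: "1 < x" "x < y" "?r x = 0" "?r y = 0" for x y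
  proof -
    define S where "S = (\<lambda>t. t * ?r' t - real n * ?r t)"
    define f where "f = (\<lambda>t. t powr (c - 1) * ((t - 1) powr (b - n + 1 - c) * (?r t * S t)))"
    obtain z where z: "x < z" "z < y" "(z - 1) * (S z)\<^sup>2 + n * (n + c - 1) * (?r z)\<^sup>2 = 0"
    proof (rule weighted_Rolle[of x y f "\<lambda>t. t powr (c - 2) * (t - 1) powr (b - n - c)"
          "\<lambda>t. (t - 1) * (S t)\<^sup>2 + n * (n + c - 1) * (?r t)\<^sup>2"])
      show "f x = 0" "f y = 0" using xy by (auto simp: f_def)
      show "continuous_on {x..y} f"
        unfolding f_def S_def using xy by (auto intro!: continuous_intros)
      fix t assume t: "x < t" "t < y"
      then have t1: "t > 1" using xy by simp
      have pw: "t powr (c - 1) = t powr (c - 2) * t"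
        using t1 by (simp add: powr_diff power2_eq_square powr_numeral)
      have pw': "(t - 1) powr (b - n + 1 - c) = (t - 1) powr (b - n - c) * (t - 1)"
        using t1 by (simp add: powr_add powr_diff)
      have d1: "((\<lambda>t. t powr (c - 1)) has_real_derivative (c - 1) * t powr (c - 2)) (at t)"
        using has_real_derivative_powr[of t "c - 1"] t1 by simp
      have d2: "((\<lambda>t. (t - 1) powr (b - n + 1 - c)) has_real_derivative
          (b - n + 1 - c) * (t - 1) powr (b - n - c)) (at t)"
      proof -
        have "((\<lambda>t. (t - 1) powr (b - n + 1 - c)) has_real_derivative
          (b - n + 1 - c) * (t - 1) powr (b - n + 1 - c - 1) * 1) (at t)"
          by (rule DERIV_chain2[where g = "\<lambda>t. t - 1" and x = t, OF has_real_derivative_powr])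
             (use t1 in \<open>auto intro!: derivative_eq_intros\<close>)
        moreover have "b - n + 1 - c - 1 = b - n - c" by simp
        ultimately show ?thesis by (simp only: mult_1_right)
      qed
      have d3: "(S has_real_derivative t * ?r'' t + ?r' t - n * ?r' t) (at t)"
        unfolding S_def by (auto intro!: derivative_eq_intros)
      have "(f has_real_derivative
         ((c - 1) * t powr (c - 2)) * ((t - 1) powr (b - n + 1 - c) * (?r t * S t)) +
         (((b - n + 1 - c) * (t - 1) powr (b - n - c)) * (?r t * S t) +
           (?r' t * S t + (t * ?r'' t + ?r' t - n * ?r' t) * ?r t) * (t - 1) powr (b - n + 1 - c))
           * t powr (c - 1)) (at t)"
        unfolding f_def by (intro DERIV_mult d1 d2 d3 poly_DERIV)
      also have "((c - 1) * t powr (c - 2)) * ((t - 1) powr (b - n + 1 - c) * (?r t * S t)) +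
         (((b - n + 1 - c) * (t - 1) powr (b - n - c)) * (?r t * S t) +
           (?r' t * S t + (t * ?r'' t + ?r' t - n * ?r' t) * ?r t) * (t - 1) powr (b - n + 1 - c))
           * t powr (c - 1)
        = t powr (c - 2) * (t - 1) powr (b - n - c) *
          ((c - 1) * (t - 1) * (?r t * S t) + t * (b - n + 1 - c) * (?r t * S t) +
           t * (t - 1) * (?r' t * S t + ?r t * (t * ?r'' t + ?r' t - n * ?r' t)))"
        unfolding pw pw' by algebra
      also have "(c - 1) * (t - 1) * (?r t * S t) + t * (b - n + 1 - c) * (?r t * S t) +
           t * (t - 1) * (?r' t * S t + ?r t * (t * ?r'' t + ?r' t - n * ?r' t))
         = (t - 1) * (S t)\<^sup>2 + n * (n + c - 1) * (?r t)\<^sup>2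
           - t * ?r t * (t * (1 - t) * ?r'' t + (c - (b - n + 1) * t) * ?r' t + n * b * ?r t)"
        unfolding S_def by algebra
      also have "\<dots> = (t - 1) * (S t)\<^sup>2 + n * (n + c - 1) * (?r t)\<^sup>2"
        unfolding hyp_ode[OF assms(1)] by simp
      finally show "(f has_real_derivative t powr (c - 2) * (t - 1) powr (b - n - c) *
          ((t - 1) * (S t)\<^sup>2 + n * (n + c - 1) * (?r t)\<^sup>2)) (at t)" .
      show "t powr (c - 2) * (t - 1) powr (b - n - c) \<noteq> 0" using t1 by simp
    qed (use xy in auto)
    have "n * (n + c - 1) > 0" using assms by simp
    moreover have "z - 1 > 0" using z xy by simp
    ultimately have "(S z)\<^sup>2 = 0" "(?r z)\<^sup>2 = 0"
      using z(3) by (auto simp: add_nonneg_eq_0_iff)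
    then have "?r z = 0" "?r' z = 0"
      using \<open>z - 1 > 0\<close> by (auto simp: S_def)
    then show False using simple_zero_hyp[of c z n b] assms \<open>z - 1 > 0\<close> by simp
  qed
  have "card {x \<in> {1<..}. ?r x = 0} \<le> card ({} :: real set) + 1"
    by (rule card_le_interlacing[OF finite_zeros]) (use no_two in auto)
  then show ?thesis by simp
qed

section \<open>The zero counts in terms of the negative axis\<close>

abbreviation neg_zeros :: "nat \<Rightarrow> real \<Rightarrow> real \<Rightarrow> real set" where
  "neg_zeros n b c \<equiv> {x \<in> {..<0}. poly (hyp n b c) x = 0}"

lemma card_zeros_unit_interval:
  assumes "c > 0"
  shows "card {x \<in> {0<..<1}. poly (hyp n b c) x = 0} = card (neg_zeros n (c - b) c)"
proof -
  have inv: "x / (x - 1) / (x / (x - 1) - 1) = x" if "x \<noteq> 1" for x :: real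
    using that by (simp add: field_simps)
  have "bij_betw (\<lambda>x. x / (x - 1)) {x \<in> {0<..<1}. poly (hyp n b c) x = 0} (neg_zeros n (c - b) c)"
  proof (rule bij_betw_byWitness[where f' = "\<lambda>x. x / (x - 1)"])
    show "(\<lambda>x. x / (x - 1)) ` {x \<in> {0<..<1}. poly (hyp n b c) x = 0} \<subseteq> neg_zeros n (c - b) c"
      using pfaff[OF assms, of _ n b] by (auto simp: divide_less_0_iff)
    show "(\<lambda>x. x / (x - 1)) ` neg_zeros n (c - b) c \<subseteq> {x \<in> {0<..<1}. poly (hyp n b c) x = 0}"
      using pfaff[OF assms, of _ n "c - b"] by (auto simp: zero_less_divide_iff divide_less_eq)
  qed (use inv in auto)
  then show ?thesis by (rule bij_betw_same_card)
qed

lemma degree_hypergeom_poly: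
  assumes "c > 0" "pochhammer b n \<noteq> 0"
  shows "degree (hypergeom_poly n b c) = n"
  using degree_hyp[OF assms] by (simp add: hypergeom_poly_eq_hyp degree_map_poly)

lemma hypergeom_poly_nonzero: "hypergeom_poly n b c \<noteq> 0"
  by (simp add: hypergeom_poly_eq_hyp map_poly_eq_0_iff)

text \<open>
  All zero counts are governed by the negative zeros for the parameters \<open>b\<close> and \<open>c - b\<close>. The
  two nonvanishing assumptions say that the degree is \<open>n\<close> and that \<open>1\<close> is not a zero; since the
  nonreal zeros come in pairs and there is at most one zero beyond \<open>1\<close>, the total \<open>n\<close> determines
  both remaining numbers from the first two.
\<close>
lemma zero_counts:
  fixes n :: nat and b c :: real
  assumes "n \<ge> 1" "c > 0" "pochhammer b n \<noteq> 0" "pochhammer (c - b) n \<noteq> 0"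
  defines "F \<equiv> hypergeom_poly n b c"
  shows "num_zeros_in F (complex_of_real ` {..<0}) = card (neg_zeros n b c)"
    and "num_zeros_in F (complex_of_real ` {0<..<1}) = card (neg_zeros n (c - b) c)"
    and "num_zeros_in F (complex_of_real ` {1<..}) \<le> 1"
    and "even (num_zeros_in F (- \<real>))"
    and "num_zeros_in F (complex_of_real ` {..<0}) + num_zeros_in F (complex_of_real ` {0<..<1})
         + num_zeros_in F (complex_of_real ` {1<..}) + num_zeros_in F (- \<real>) = n"
proof -
  let ?r = "hyp n b c"
  have F: "F = cpoly ?r" by (simp add: F_def hypergeom_poly_eq_hyp)
  have real: "num_zeros_in F (complex_of_real ` T) = card {x \<in> T. poly ?r x = 0}"
    if "0 \<notin> T" "1 \<notin> T" for T
    unfolding F using that assms(2) by (intro num_zeros_in_real simple_zero_hyp) auto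
  show "num_zeros_in F (complex_of_real ` {..<0}) = card (neg_zeros n b c)"
    by (rule real) auto
  show "num_zeros_in F (complex_of_real ` {0<..<1}) = card (neg_zeros n (c - b) c)"
    using real[of "{0<..<1}"] card_zeros_unit_interval[OF assms(2)] by simp
  show "num_zeros_in F (complex_of_real ` {1<..}) \<le> 1"
    using real[of "{1<..}"] at_most_one_zero_beyond_1[OF assms(2,1)] by simp
  show "even (num_zeros_in F (- \<real>))"
    unfolding F by (rule even_nonreal_zeros)
  have nz: "F \<noteq> 0" by (simp add: F_def hypergeom_poly_nonzero)
  have "pochhammer c n > 0" using assms(2) by (rule pochhammer_pos)
  then have "poly ?r 0 \<noteq> 0" "poly ?r 1 \<noteq> 0"
    using assms(4) by (auto simp: poly_hyp_1[OF assms(2)])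
  then have "num_zeros_in F (complex_of_real ` {0, 1}) = 0"
    unfolding num_zeros_in_eq_0_iff[OF nz] using poly_cpoly[of ?r 0] poly_cpoly[of ?r 1]
    by (simp add: F)
  moreover have whole: "(UNIV :: real set) = {0, 1} \<union> ({..<0} \<union> ({0<..<1} \<union> {1<..}))"
    by auto
  have "num_zeros_in F \<real>
     = num_zeros_in F (complex_of_real ` {0, 1}) + (num_zeros_in F (complex_of_real ` {..<0})
         + (num_zeros_in F (complex_of_real ` {0<..<1}) + num_zeros_in F (complex_of_real ` {1<..})))"
    unfolding Reals_def whole image_Un by (subst num_zeros_in_Un, force)+ simp
  ultimately have reals: "num_zeros_in F \<real> = num_zeros_in F (complex_of_real ` {..<0})
         + num_zeros_in F (complex_of_real ` {0<..<1}) + num_zeros_in F (complex_of_real ` {1<..})"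
    by simp
  have "num_zeros_in F (\<real> \<union> - \<real>) = num_zeros_in F \<real> + num_zeros_in F (- \<real>)"
    by (rule num_zeros_in_Un) auto
  moreover have "num_zeros_in F (\<real> \<union> - \<real>) = n"
    using degree_hypergeom_poly[OF assms(2,3)] by (simp add: num_zeros_in_UNIV F_def)
  ultimately show "num_zeros_in F (complex_of_real ` {..<0}) + num_zeros_in F (complex_of_real ` {0<..<1})
         + num_zeros_in F (complex_of_real ` {1<..}) + num_zeros_in F (- \<real>) = n"
    using reals by simp
qed

text \<open>
  Rolle's theorem for \<open>\<bar>x\<bar>\<^sup>b F\<close>. The inequality serves twice: iterated upwards until
  \<open>b\<close> is positive it bounds the number of zeros from above, and iterated downwards until
  \<open>b < 1 - n\<close> it bounds that number from below.
\<close>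
lemma card_neg_zeros_step:
  assumes "c > 0" "b \<noteq> 0"
  shows "card (neg_zeros n b c) \<le> card (neg_zeros n (b + 1) c) + 1"
proof (rule card_le_interlacing)
  fix x y assume xy: "x \<in> neg_zeros n b c" "y \<in> neg_zeros n b c" "x < y"
  let ?r = "poly (hyp n b c)"
  obtain z where "x < z" "z < y" "poly (hyp n (b + 1) c) z = 0"
  proof (rule weighted_Rolle[of x y "\<lambda>t. (- t) powr b * ?r t" "\<lambda>t. - b * (- t) powr (b - 1)"
        "poly (hyp n (b + 1) c)"])
    show "continuous_on {x..y} (\<lambda>t. (- t) powr b * ?r t)"
      using xy by (auto intro!: continuous_intros)
    fix t assume "x < t" "t < y"
    then have t: "t < 0" using xy by simp
    have d1: "((\<lambda>t. (- t) powr b) has_real_derivative b * (- t) powr (b - 1) * (- 1)) (at t)"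
      by (rule DERIV_chain2[where g = uminus and x = t, OF has_real_derivative_powr])
         (use t in \<open>auto intro!: derivative_eq_intros\<close>)
    have "((\<lambda>t. (- t) powr b * ?r t) has_real_derivative
       b * (- t) powr (b - 1) * (- 1) * ?r t + poly (pderiv (hyp n b c)) t * (- t) powr b) (at t)"
      by (intro DERIV_mult d1 poly_DERIV)
    also have "(- t) powr b = (- t) powr (b - 1) * (- t)"
      using t by (simp add: powr_diff)
    also have "b * (- t) powr (b - 1) * (- 1) * ?r t + poly (pderiv (hyp n b c)) t * ((- t) powr (b - 1) * (- t))
       = - ((- t) powr (b - 1)) * (b * ?r t + t * poly (pderiv (hyp n b c)) t)"
      by (simp add: algebra_simps)
    also have "\<dots> = - b * (- t) powr (b - 1) * poly (hyp n (b + 1) c) t"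
      unfolding hyp_raise_b by simp
    finally show "((\<lambda>t. (- t) powr b * ?r t) has_real_derivative
        - b * (- t) powr (b - 1) * poly (hyp n (b + 1) c) t) (at t)" .
    show "- b * (- t) powr (b - 1) \<noteq> 0" using t assms by simp
  qed (use xy in auto)
  moreover have "y < 0" using xy by simp
  ultimately show "\<exists>z\<in>neg_zeros n (b + 1) c. x < z \<and> z < y"
    by (intro bexI[of _ z]) auto
qed (rule finite_zeros)+

text \<open>
  The zeros of the weighted function are the negative zeros of \<open>F(-n, b; c + 1; x)\<close> together with
  \<open>0\<close>, so the gaps between them are as many as those negative zeros.
\<close>
lemma card_neg_zeros_raise_n:
  assumes "c > 0"
  shows "card (neg_zeros n b (c + 1)) \<le> card (neg_zeros (Suc n) b c)"
proof -
  let ?q = "poly (hyp n b (c + 1))"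
  have "card (insert 0 (neg_zeros n b (c + 1))) \<le> card (neg_zeros (Suc n) b c) + 1"
  proof (rule card_le_interlacing)
    fix x y assume xy: "x \<in> insert 0 (neg_zeros n b (c + 1))" "y \<in> insert 0 (neg_zeros n b (c + 1))" "x < y"
    obtain z where "x < z" "z < y" "poly (hyp (Suc n) b c) z = 0"
    proof (rule weighted_Rolle[of x y "\<lambda>t. (- t) powr c * ((1 - t) powr (b - c) * ?q t)"
          "\<lambda>t. - c * (- t) powr (c - 1) * (1 - t) powr (b - c - 1)" "poly (hyp (Suc n) b c)"])
      show "continuous_on {x..y} (\<lambda>t. (- t) powr c * ((1 - t) powr (b - c) * ?q t))"
        using xy assms by (auto intro!: continuous_intros continuous_on_powr')
      show "(- x) powr c * ((1 - x) powr (b - c) * ?q x) = 0"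
        "(- y) powr c * ((1 - y) powr (b - c) * ?q y) = 0"
        using xy by auto
      fix t assume "x < t" "t < y"
      then have t: "t < 0" using xy by auto
      have d1: "((\<lambda>t. (- t) powr c) has_real_derivative c * (- t) powr (c - 1) * (- 1)) (at t)"
        by (rule DERIV_chain2[where g = uminus and x = t, OF has_real_derivative_powr])
           (use t in \<open>auto intro!: derivative_eq_intros\<close>)
      have d2: "((\<lambda>t. (1 - t) powr (b - c)) has_real_derivative (b - c) * (1 - t) powr (b - c - 1) * (- 1)) (at t)"
        by (rule DERIV_chain2[where g = "\<lambda>t. 1 - t" and x = t, OF has_real_derivative_powr])
           (use t in \<open>auto intro!: derivative_eq_intros\<close>)
      have "((\<lambda>t. (- t) powr c * ((1 - t) powr (b - c) * ?q t)) has_real_derivative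
         c * (- t) powr (c - 1) * (- 1) * ((1 - t) powr (b - c) * ?q t) +
         ((b - c) * (1 - t) powr (b - c - 1) * (- 1) * ?q t +
           poly (pderiv (hyp n b (c + 1))) t * (1 - t) powr (b - c)) * (- t) powr c) (at t)"
        by (intro DERIV_mult d1 d2 poly_DERIV)
      also have "(- t) powr c = (- t) powr (c - 1) * (- t)"
        using t by (simp add: powr_diff)
      also have "(1 - t) powr (b - c) = (1 - t) powr (b - c - 1) * (1 - t)"
        using t by (simp add: powr_diff)
      also have "c * (- t) powr (c - 1) * (- 1) * ((1 - t) powr (b - c - 1) * (1 - t) * ?q t) +
         ((b - c) * (1 - t) powr (b - c - 1) * (- 1) * ?q t +
           poly (pderiv (hyp n b (c + 1))) t * ((1 - t) powr (b - c - 1) * (1 - t))) * ((- t) powr (c - 1) * (- t))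
        = - ((- t) powr (c - 1)) * (1 - t) powr (b - c - 1) *
          ((c - b * t) * ?q t + t * (1 - t) * poly (pderiv (hyp n b (c + 1))) t)"
        by algebra
      also have "\<dots> = - c * (- t) powr (c - 1) * (1 - t) powr (b - c - 1) * poly (hyp (Suc n) b c) t"
        unfolding hyp_raise_n[OF assms] by simp
      finally show "((\<lambda>t. (- t) powr c * ((1 - t) powr (b - c) * ?q t)) has_real_derivative
          - c * (- t) powr (c - 1) * (1 - t) powr (b - c - 1) * poly (hyp (Suc n) b c) t) (at t)" .
      show "- c * (- t) powr (c - 1) * (1 - t) powr (b - c - 1) \<noteq> 0" using t assms by simp
    qed (use xy in auto)
    moreover have "y \<le> 0" using xy by auto
    ultimately show "\<exists>z\<in>neg_zeros (Suc n) b c. x < z \<and> z < y"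
      by (intro bexI[of _ z]) auto
  qed (simp_all only: finite_zeros finite_insert)
  moreover have "card (insert 0 (neg_zeros n b (c + 1))) = Suc (card (neg_zeros n b (c + 1)))"
    by (rule card_insert_disjoint[OF finite_zeros]) simp
  ultimately show ?thesis by simp
qed

lemma card_neg_zeros_pos:
  assumes "c > 0" "b > 0"
  shows "card (neg_zeros n b c) = 0"
proof -
  have "poly (hyp n b c) x \<noteq> 0" if "x < 0" for x
    using hyp_pos_negative_axis[OF assms that, of n] by simp
  then have "neg_zeros n b c = {}" by blast
  then show ?thesis by (simp only: card.empty)
qed

text \<open>
  By induction, the passage from \<open>n\<close> to \<open>n + 1\<close> provides \<open>n\<close> negative zeros out of \<open>n + 1\<close>. All
  coefficients are positive, so the last zero is not positive; it cannot be nonreal because the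
  nonreal zeros are even in number. Hence it is negative, too.
\<close>
lemma card_neg_zeros_all:
  assumes "b < 1 - real n" "c > 0"
  shows "card (neg_zeros n b c) = n"
  using assms
proof (induction n arbitrary: c)
  case 0
  then show ?case by (simp add: hyp_def)
next
  case (Suc n)
  let ?F = "hypergeom_poly (Suc n) b c"
  have "n \<le> card (neg_zeros (Suc n) b c)"
    using Suc.IH[of "c + 1"] Suc.prems card_neg_zeros_raise_n[of c n b] by simp
  moreover have "num_zeros_in ?F (complex_of_real ` {1<..}) = 0"
  proof -
    have "poly (hyp (Suc n) b c) x \<noteq> 0" if "x > 1" for x
      using hyp_pos_positive_axis[of c b "Suc n" x] Suc.prems that by simp
    then show ?thesis
      unfolding num_zeros_in_eq_0_iff[OF hypergeom_poly_nonzero]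
      by (simp add: hypergeom_poly_eq_hyp poly_cpoly)
  qed
  moreover have "card (neg_zeros (Suc n) (c - b) c) = 0"
    using Suc.prems by (intro card_neg_zeros_pos) auto
  moreover have "pochhammer b (Suc n) \<noteq> 0" "pochhammer (c - b) (Suc n) \<noteq> 0"
    using Suc.prems by (auto simp: pochhammer_eq_0_iff)
  note counts = zero_counts[OF _ Suc.prems(2) this, simplified]
  have "even (num_zeros_in ?F (- \<real>))" "card (neg_zeros (Suc n) b c) + card (neg_zeros (Suc n) (c - b) c)
       + num_zeros_in ?F (complex_of_real ` {1<..}) + num_zeros_in ?F (- \<real>) = Suc n"
    using counts(4,5) unfolding counts(1,2) by simp_all
  (* an even number of nonreal zeros, bounded by 1, is 0 *)
  ultimately show ?case by presburger
qed

text \<open>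
  After \<open>j\<close> unit steps the parameter is positive, and there are no negative zeros left.
\<close>
lemma card_neg_zeros_le:
  assumes "c > 0" "- real j < b" "b < - real j + 1"
  shows "card (neg_zeros n b c) \<le> j"
  using assms
proof (induction j arbitrary: b)
  case 0
  then show ?case using card_neg_zeros_pos[of c b n] by simp
next
  case (Suc j)
  then have "card (neg_zeros n (b + 1) c) \<le> j" by (intro Suc.IH) auto
  moreover have "b \<noteq> 0" using Suc.prems by auto
  ultimately show ?case using card_neg_zeros_step[of c b n] Suc.prems by simp
qed

text \<open>
  After \<open>i\<close> unit steps downwards the parameter lies below \<open>1 - n\<close>, where all zeros are negative;
  every step back loses at most one of them. As \<open>b\<close> is not an integer, the excluded
  parameter \<open>0\<close> is never met.
\<close>
lemma card_neg_zeros_ge: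
  assumes "c > 0" "b < 1 - real n + real i" "b \<notin> \<int>"
  shows "n \<le> card (neg_zeros n b c) + i"
  using assms
proof (induction i arbitrary: b)
  case 0
  then show ?case using card_neg_zeros_all[of b n c] by simp
next
  case (Suc i)
  have "n \<le> card (neg_zeros n (b - 1) c) + i" using Suc.prems by (intro Suc.IH) auto
  moreover have "b - 1 \<noteq> 0" using Suc.prems by auto
  ultimately show ?case using card_neg_zeros_step[of c "b - 1" n] Suc.prems by simp
qed

lemma card_neg_zeros_eq:
  assumes "c > 0" "j \<le> n" "- real j < b" "b < - real j + 1"
  shows "card (neg_zeros n b c) = j"
proof (rule antisym)
  have "b \<notin> \<int>"
  proof
    assume "b \<in> \<int>"
    then obtain k where "b = of_int k" by (rule Ints_cases)
    then have "- int j < k" "k < - int j + 1" using assms by linarith+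
    then show False by simp
  qed
  then show "j \<le> card (neg_zeros n b c)"
    using card_neg_zeros_ge[of c b n "n - j"] assms by (simp add: of_nat_diff)
qed (use card_neg_zeros_le assms in auto)

lemma pochhammer_between_nonzero:
  assumes "- real j < b" "b < - real j + 1"
  shows "pochhammer b n \<noteq> 0"
proof
  assume "pochhammer b n = 0"
  then obtain k where "b = - real k" by (auto simp: pochhammer_eq_0_iff)
  then show False using assms by simp
qed

theorem theorem3p2:
  fixes n :: nat and b c :: real and F :: "complex poly"
  assumes "n \<ge> 1" and "c > 0"
  defines "F \<equiv> hypergeom_poly n b c"
  shows
    "(b > c + real n \<longrightarrow>
        (\<forall>z. poly F z = 0 \<longrightarrow> z \<in> complex_of_real ` {0<..<1}))
   \<and> (c < b \<and> b < c + real n \<longrightarrow>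
        (\<forall>j\<in>{1..n}. c + real j - 1 < b \<and> b < c + real j \<longrightarrow>
           num_zeros_in F (complex_of_real ` {0<..<1}) = j \<and>
           (even (n - j) \<longrightarrow> num_zeros_in F (- \<real>) = n - j) \<and>
           (odd (n - j) \<longrightarrow> num_zeros_in F (- \<real>) = n - j - 1 \<and>
                            num_zeros_in F (complex_of_real ` {1<..}) = 1)))
   \<and> (0 < b \<and> b < c \<longrightarrow>
        (even n \<longrightarrow> (\<forall>z. poly F z = 0 \<longrightarrow> z \<notin> \<real>)) \<and>
        (odd n \<longrightarrow> num_zeros_in F (complex_of_real ` {1<..}) = 1 \<and>
                    num_zeros_in F (- \<real>) = n - 1))
   \<and> (- real n < b \<and> b < 0 \<longrightarrow>
        (\<forall>j\<in>{1..n}. - real j < b \<and> b < - real j + 1 \<longrightarrow>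
           num_zeros_in F (complex_of_real ` {..<0}) = j \<and>
           (even (n - j) \<longrightarrow> num_zeros_in F (- \<real>) = n - j) \<and>
           (odd (n - j) \<longrightarrow> num_zeros_in F (- \<real>) = n - j - 1 \<and>
                            num_zeros_in F (complex_of_real ` {1<..}) = 1)))
   \<and> (b < - real n \<longrightarrow>
        (\<forall>z. poly F z = 0 \<longrightarrow> z \<in> complex_of_real ` {..<0}))"
proof -
  let ?N = "num_zeros_in F"
  let ?neg = "?N (complex_of_real ` {..<0})" and ?unit = "?N (complex_of_real ` {0<..<1})"
    and ?beyond = "?N (complex_of_real ` {1<..})" and ?nonreal = "?N (- \<real>)"
  have nz: "F \<noteq> 0" by (simp add: F_def hypergeom_poly_nonzero)
  have all_in: "z \<in> S" if "?N S = n" "pochhammer b n \<noteq> 0" "poly F z = 0" for S z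
  proof -
    have "?N (S \<union> - S) = ?N S + ?N (- S)" by (rule num_zeros_in_Un) auto
    moreover have "?N (S \<union> - S) = n"
      using degree_hypergeom_poly[OF assms(2) that(2)] by (simp add: num_zeros_in_UNIV F_def)
    ultimately have "?N (- S) = 0" using that by simp
    then show ?thesis using that unfolding num_zeros_in_eq_0_iff[OF nz] by auto
  qed
  have split: "(even (n - j) \<longrightarrow> ?nonreal = n - j) \<and> (odd (n - j) \<longrightarrow> ?nonreal = n - j - 1 \<and> ?beyond = 1)"
    if "j + ?beyond + ?nonreal = n" "?beyond \<le> 1" "even ?nonreal" for j
  proof -
    have "?beyond = 0 \<or> ?beyond = 1" using that(2) by linarith
    then show ?thesis using that(1,3) by (auto simp flip: that(1))
  qed
  have pos: "pochhammer x n \<noteq> 0" if "x > 0" for x :: real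
    using pochhammer_pos[OF that, of n] by simp
  note counts = zero_counts[OF assms(1,2), of b, folded F_def]
  have neg0: "card (neg_zeros n x c) = 0" if "x > 0" for x
    using card_neg_zeros_pos[OF assms(2) that] .
  show ?thesis
  proof (intro conjI, goal_cases)
    case 1
    show ?case
    proof (intro impI allI)
      fix z assume b: "b > c + real n" and z: "poly F z = 0"
      have ph: "pochhammer b n \<noteq> 0" "pochhammer (c - b) n \<noteq> 0"
        using b assms(2) by (auto intro: pos simp: pochhammer_eq_0_iff)
      have "?unit = n"
        using counts(2)[OF ph] card_neg_zeros_all[of "c - b" n c] b assms(2) by simp
      then show "z \<in> complex_of_real ` {0<..<1}"
        using ph z by (intro all_in)
    qed
  next
    case 2
    show ?case
    proof (intro impI ballI)
      fix j assume j: "j \<in> {1..n}" and b: "c < b \<and> b < c + real n" "c + real j - 1 < b \<and> b < c + real j"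
      have ph: "pochhammer b n \<noteq> 0" "pochhammer (c - b) n \<noteq> 0"
        using b assms(2) pos[of b] pochhammer_between_nonzero[of j "c - b" n] by auto
      have "?unit = j"
        using counts(2)[OF ph] card_neg_zeros_eq[of c j n "c - b"] b j assms(2) by simp
      moreover have "?neg = 0"
        using counts(1)[OF ph] neg0[of b] b assms(2) by simp
      ultimately show "?unit = j \<and> (even (n - j) \<longrightarrow> ?nonreal = n - j) \<and>
          (odd (n - j) \<longrightarrow> ?nonreal = n - j - 1 \<and> ?beyond = 1)"
        using split[of j] counts(3-5)[OF ph] by simp
    qed
  next
    case 3
    show ?case
    proof (rule impI)
      assume b: "0 < b \<and> b < c"
      then have ph: "pochhammer b n \<noteq> 0" "pochhammer (c - b) n \<noteq> 0"
        using pos[of b] pos[of "c - b"] by auto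
      have zero: "?neg = 0" "?unit = 0"
        using counts(1,2)[OF ph] neg0[of b] neg0[of "c - b"] b by simp_all
      have *: "(even n \<longrightarrow> ?nonreal = n) \<and> (odd n \<longrightarrow> ?nonreal = n - 1 \<and> ?beyond = 1)"
        using split[of 0] zero counts(3-5)[OF ph] by simp
      have "z \<notin> \<real>" if "even n" "poly F z = 0" for z
        using all_in[of "- \<real>" z] * ph that by simp
      then show "(even n \<longrightarrow> (\<forall>z. poly F z = 0 \<longrightarrow> z \<notin> \<real>)) \<and>
          (odd n \<longrightarrow> ?beyond = 1 \<and> ?nonreal = n - 1)"
        using * by blast
    qed
  next
    case 4
    show ?case
    proof (intro impI ballI)
      fix j assume j: "j \<in> {1..n}" and b: "- real n < b \<and> b < 0" "- real j < b \<and> b < - real j + 1"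
      have ph: "pochhammer b n \<noteq> 0" "pochhammer (c - b) n \<noteq> 0"
        using b assms(2) pos[of "c - b"] pochhammer_between_nonzero[of j b n] by auto
      have "?neg = j"
        using counts(1)[OF ph] card_neg_zeros_eq[of c j n b] b j assms(2) by simp
      moreover have "?unit = 0"
        using counts(2)[OF ph] neg0[of "c - b"] b assms(2) by simp
      ultimately show "?neg = j \<and> (even (n - j) \<longrightarrow> ?nonreal = n - j) \<and>
          (odd (n - j) \<longrightarrow> ?nonreal = n - j - 1 \<and> ?beyond = 1)"
        using split[of j] counts(3-5)[OF ph] by simp
    qed
  next
    case 5
    show ?case
    proof (intro impI allI)
      fix z assume b: "b < - real n" and z: "poly F z = 0"
      have ph: "pochhammer b n \<noteq> 0" "pochhammer (c - b) n \<noteq> 0"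
        using b assms(2) by (auto intro: pos simp: pochhammer_eq_0_iff)
      have "?neg = n"
        using counts(1)[OF ph] card_neg_zeros_all[of b n c] b assms(2) by simp
      then show "z \<in> complex_of_real ` {..<0}"
        using ph z by (intro all_in)
    qed
  qed
qed

end
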